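(* Let $\mathcal{F}^{PC}$, $\mathcal{G}^{PC}$ and $\Psi_0^{PC}(\cdot\,;\theta^* )$ be the maps described in the context, with parameters $\theta^*=(E',\nu',L',\alpha,\beta)$ arising from a piecewise-constant Kelvin-Voigt material with $L'+1$ pieces whose elasticity $E$ and viscosity $\nu$ satisfy $E^+,\nu^+<\infty$ and $E^-,\nu^->0$. Assume that there exist $\rho>0$ and $0\le B<\infty$ such that $\rho<\min_\ell|\alpha_\ell|$ and $\max_\ell|\beta_\ell|\le B$. Let $R>0$. Then for every $\eta>0$ there exist neural networks $\mathcal{F}^{RNN}:\mathbb{R}\times\mathbb{R}\times\mathbb{R}^{L'}\to\mathbb{R}$ and $\mathcal{G}^{RNN}:\mathbb{R}^{L'}\times\mathbb{R}\to\mathbb{R}^{L'}$ such that the map $\Psi_0^{RNN}$ defined by $$\Psi_0^{RNN}\left(b(t),c(t),\{b(\tau)\}_{\tau\in\overline{\mathcal{T}}},t\right)=\mathcal{F}^{RNN}\left(b(t),c(t),\xi(t)\right),\qquad \dot\xi(t)=\mathcal{G}^{RNN}\left(\xi(t),b(t)\right),\quad \xi(0)=0,$$ satisfies $$\sup_{t\in\mathcal{T},\ b,c\in\mathsf{Z}_R}\left|\Psi_0^{PC}\left(b(t),c(t),\{b(\tau)\}_{\tau\in\overline{\mathcal{T}}},t;\theta^*\right)-\Psi_0^{RNN}\left(b(t),c(t),\{b(\tau)\}_{\tau\in\overline{\mathcal{T}}},t\right)\right|<\eta.$$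
   Context: $\mathcal{T}=(0,T)$ with $T<\infty$, and $\mathsf{Z}_R=\{w:\mathbb{R}^+\to\mathbb{R}\ :\ \sup_{t\in\mathcal{T}}|w(t)|\le R\}$; the function $b$ whose history enters the constitutive maps is taken continuous on $\overline{\mathcal{T}}$. For a bounded function $\xi$, $\xi^\pm$ denote its essential supremum and infimum. Parameters: $E,\nu$ are constant on each of $L'+1$ common intervals partitioning the unit cell $[0,1]$, and $(E',\nu',\alpha,\beta)$ with $E',\nu'>0$, $\alpha\in\mathbb{R}_+^{L'}$, $\beta\in\mathbb{R}^{L'}$ are such that $\left(\int_0^1\frac{dy}{s\nu(y)+E(y)}\right)^{-1}=E'+\nu's-\sum_{\ell=1}^{L'}\frac{\beta_\ell}{s+\alpha_\ell}$. With $A=\mathrm{diag}(\alpha_1,\dots,\alpha_{L'})$ and $\mathds{1}=(1,\dots,1)\in\mathbb{R}^{L'}$ define $$\mathcal{F}^{PC}(b,c,r)=E'b+\nu'c-\langle\mathds{1},r\rangle,\qquad \mathcal{G}^{PC}(r,b)=-Ar+\beta b,$$ for $b,c\in\mathbb{R}$, $r\in\mathbb{R}^{L'}$, and $$\Psi_0^{PC}\left(b(t),c(t),\{b(\tau)\}_{\tau\in\overline{\mathcal{T}}},t;\theta^*\right)=\mathcal{F}^{PC}\left(b(t),c(t),\xi(t)\right),\qquad \dot\xi(t)=\mathcal{G}^{PC}\left(\xi(t),b(t)\right),\quad \xi(0)=0.$$ Neural networks: a class of continuous maps between Euclidean spaces with the universal approximation property (for instance one-hidden-layer networks with a continuous sigmoidal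 activation, by Cybenko's theorem). That is, the paper takes as given: for all compact $D_1\subset\mathbb{R}^{2+L'}$, $D_2\subset\mathbb{R}^{1+L'}$ and every $\delta>0$, there exist networks $\mathcal{F}^{RNN},\mathcal{G}^{RNN}$ in the class with $\sup_{z\in D_1}|\mathcal{F}^{PC}(z)-\mathcal{F}^{RNN}(z)|\le\delta$ and $\sup_{z\in D_2}\|\mathcal{G}^{PC}(z)-\mathcal{G}^{RNN}(z)\|\le\delta$ (Euclidean norm). *)

theory Defs
  imports "HOL-Probability.Essential_Supremum" "HOL-Library.Disjoint_Sets"
begin

text \<open>The unit cell is \<open>{0..1}\<close>. Essential bounds are taken in the extended reals, so that finiteness
  of \<open>ess_sup\<close> is a genuine hypothesis.\<close>

definition ess_sup :: "(real \<Rightarrow> real) \<Rightarrow> ereal" where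
  "ess_sup f = esssup (lebesgue_on {0..1}) (\<lambda>y. ereal (f y))"

definition ess_inf :: "(real \<Rightarrow> real) \<Rightarrow> ereal" where
  "ess_inf f = - esssup (lebesgue_on {0..1}) (\<lambda>y. - ereal (f y))"

text \<open>The pieces are nondegenerate intervals, common to both functions; no convention is imposed on
  which piece contains a breakpoint, and adjacent pieces may carry the same values.\<close>

definition piecewise_constant_material :: "nat \<Rightarrow> (real \<Rightarrow> real) \<Rightarrow> (real \<Rightarrow> real) \<Rightarrow> bool" where
  "piecewise_constant_material n E \<nu> \<longleftrightarrow>
     (\<exists>P. partition_on {0..1} P \<and> card P = n \<and>
        (\<forall>I\<in>P. is_interval I \<and> interior I \<noteq> {} \<and> E constant_on I \<and> \<nu> constant_on I))"

text \<open>The number \<open>L'\<close> of internal variables is \<open>CARD('l)\<close>. The partial fraction decomposition is an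
  identity of rational functions in the Laplace variable \<open>s\<close>; it is required on the open right
  half-plane, where no denominator vanishes when \<open>E\<close> and \<open>\<nu>\<close> are positive and \<open>\<alpha>\<close> is nonnegative.\<close>

definition homogenized_parameters ::
  "(real \<Rightarrow> real) \<Rightarrow> (real \<Rightarrow> real) \<Rightarrow> real \<Rightarrow> real \<Rightarrow> real ^ 'l \<Rightarrow> real ^ 'l \<Rightarrow> bool" where
  "homogenized_parameters E \<nu> E' \<nu>' \<alpha> \<beta> \<longleftrightarrow>
     E' > 0 \<and> \<nu>' > 0 \<and> (\<forall>l. \<alpha> $ l \<ge> 0) \<and>
     (\<forall>s::complex. Re s > 0 \<longrightarrow>
        inverse (LINT y|lebesgue_on {0..1}. 1 / (s * of_real (\<nu> y) + of_real (E y)))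
        = of_real E' + of_real \<nu>' * s
          - (\<Sum>l\<in>UNIV. of_real (\<beta> $ l) / (s + of_real (\<alpha> $ l))))"

definition F_PC :: "real \<Rightarrow> real \<Rightarrow> real \<times> real \<times> (real ^ 'l) \<Rightarrow> real" where
  "F_PC E' \<nu>' = (\<lambda>(b, c, r). E' * b + \<nu>' * c - (\<chi> l. 1) \<bullet> r)"

definition diag :: "real ^ 'l \<Rightarrow> real ^ 'l ^ 'l" where
  "diag a = (\<chi> i j. if i = j then a $ i else 0)"

definition G_PC :: "real ^ 'l \<Rightarrow> real ^ 'l \<Rightarrow> (real ^ 'l) \<times> real \<Rightarrow> real ^ 'l" where
  "G_PC \<alpha> \<beta> = (\<lambda>(r, b). - (diag \<alpha> *v r) + b *\<^sub>R \<beta>)"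

text \<open>Approximability of a single map by a class of networks, to any
  accuracy, uniformly on any compact set. The norm on product types is the Euclidean one.\<close>

definition approximable_by ::
  "('a::euclidean_space \<Rightarrow> 'b::euclidean_space) \<Rightarrow> ('a \<Rightarrow> 'b) set \<Rightarrow> bool" where
  "approximable_by f N \<longleftrightarrow>
     (\<forall>D \<delta>. compact D \<and> \<delta> > 0 \<longrightarrow> (\<exists>g\<in>N. \<forall>z\<in>D. norm (f z - g z) \<le> \<delta>))"

text \<open>Functions on the nonnegative half-line are modelled by functions on \<open>real\<close>, whose values at
  negative arguments are never used.\<close>

definition Z :: "real \<Rightarrow> real \<Rightarrow> (real \<Rightarrow> real) set" where
  "Z T R = {w. (SUP t\<in>{0<..<T}. ereal \<bar>w t\<bar>) \<le> ereal R}"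

definition internal_state ::
  "real \<Rightarrow> ((real ^ 'l) \<times> real \<Rightarrow> real ^ 'l) \<Rightarrow> (real \<Rightarrow> real) \<Rightarrow> (real \<Rightarrow> real ^ 'l) \<Rightarrow> bool" where
  "internal_state T G b \<xi> \<longleftrightarrow> \<xi> 0 = 0 \<and>
     (\<forall>t\<in>{0..T}. (\<xi> has_vector_derivative G (\<xi> t, b t)) (at t within {0..T}))"

text \<open>The constitutive map, as the set of all its values: for a merely continuous \<open>G\<close> the state
  equation may have several solutions.\<close>

definition \<Psi>\<^sub>0 ::
  "real \<Rightarrow> (real \<times> real \<times> (real ^ 'l) \<Rightarrow> real) \<Rightarrow> ((real ^ 'l) \<times> real \<Rightarrow> real ^ 'l)
    \<Rightarrow> (real \<Rightarrow> real) \<Rightarrow> (real \<Rightarrow> real) \<Rightarrow> real \<Rightarrow> real set" where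
  "\<Psi>\<^sub>0 T F G b c t = {F (b t, c t, \<xi> t) |\<xi>. internal_state T G b \<xi>}"

end

(* Since every alpha_l exceeds rho, a component y' = -alpha_l y + g of the state equation satisfies
   |y| <= sup |g| / rho uniformly in time. With g = beta_l b + (approximation error of G_RNN) this
   confines every network state to a fixed box, provided the error is small on a slightly larger
   box; with g = error of G_RNN it bounds the distance of the network state to the exact state by
   delta / rho. As G_RNN is merely continuous, its states come from Peano's theorem, applied to
   G_RNN clamped to the box. *)
theory Submission
  imports Defs "HOL-Complex_Analysis.Great_Picard"
begin

section \<open>Peano existence by delayed approximations\<close>

text \<open>A delayed equation is solved by finitely many iterations: the \<open>k\<close>-th iterate is final on
  \<open>{0..k * h}\<close>.\<close>

lemma tonelli_delayed_solution:
  fixes f :: "real \<Rightarrow> 'a::euclidean_space \<Rightarrow> 'a"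
  assumes cont: "continuous_on ({0..T} \<times> UNIV) (\<lambda>(t, x). f t x)" and h: "h > 0"
  obtains x where "continuous_on {0..T} x"
    "\<And>t. t \<in> {0..T} \<Longrightarrow> x t = x0 + integral {0..t} (\<lambda>s. f s (x (max 0 (s - h))))"
proof -
  \<comment> \<open>For \<open>s \<le> h\<close> the delayed argument is held at \<open>0\<close>,
    so only values of \<open>x\<close> on \<open>{0..T}\<close> enter the integral.\<close>
  define \<Phi> where "\<Phi> x t = x0 + integral {0..t} (\<lambda>s. f s (x (max 0 (s - h))))" for x t
  define X where "X k = (\<Phi> ^^ k) (\<lambda>_. x0)" for k
  have X_Suc: "X (Suc k) = \<Phi> (X k)" for k by (simp add: X_def)
  have cont_X: "continuous_on {0..T} (X k)" for k
  proof (induction k)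
    case 0 then show ?case by (simp add: X_def)
  next
    case (Suc k)
    have "continuous_on {0..T} (\<lambda>s. X k (max 0 (s - h)))"
      by (rule continuous_on_compose2[OF Suc]) (use h in \<open>auto intro!: continuous_intros\<close>)
    then have "continuous_on {0..T} (\<lambda>s. case (s, X k (max 0 (s - h))) of (t, x) \<Rightarrow> f t x)"
      by (intro continuous_on_compose2[OF cont]) (auto intro!: continuous_intros)
    then have "(\<lambda>s. f s (X k (max 0 (s - h)))) integrable_on {0..T}"
      by (simp add: integrable_continuous_real)
    then show ?case
      unfolding X_Suc \<Phi>_def
      by (intro continuous_intros indefinite_integral_continuous_1)
  qed
  have stable: "X (Suc k) t = X k t" if "t \<in> {0..T}" "t \<le> k * h" for k t
    using that
  proof (induction k arbitrary: t)
    case 0 then have "t = 0" by auto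
    then show ?case by (simp add: X_def \<Phi>_def)
  next
    case (Suc k)
    \<comment> \<open>Up to time \<open>(k + 1) * h\<close> the integrand reads its argument no
      later than \<open>k * h\<close>, where two successive iterates already agree.\<close>
    have prev: "X (Suc k) (max 0 (s - h)) = X k (max 0 (s - h))" if "s \<in> {0..t}" for s
    proof (rule Suc.IH)
      show "max 0 (s - h) \<in> {0..T}" using that Suc.prems h by auto
      show "max 0 (s - h) \<le> k * h" using that Suc.prems h by (auto simp: algebra_simps)
    qed
    have "\<Phi> (X (Suc k)) t = \<Phi> (X k) t"
      unfolding \<Phi>_def by (intro arg_cong2[where f = "(+)"] refl integral_cong) (simp only: prev)
    then show ?case by (simp only: X_Suc)
  qed
  \<comment> \<open>Once \<open>N * h\<close> exceeds \<open>T\<close>, the iterate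
    \<open>X N\<close> is a fixed point of \<open>\<Phi>\<close> on all of
    \<open>{0..T}\<close>.\<close>
  obtain N :: nat where N: "T < N * h"
    using reals_Archimedean3[OF h] by blast
  show ?thesis
  proof
    show "continuous_on {0..T} (X N)" by (rule cont_X)
    show "X N t = x0 + integral {0..t} (\<lambda>s. f s (X N (max 0 (s - h))))" if "t \<in> {0..T}" for t
      using stable[OF that, of N] N that by (simp add: X_Suc \<Phi>_def)
  qed
qed

text \<open>Solutions of the equations with delay \<open>1 / (n + 1)\<close> are equibounded and
  share a Lipschitz constant. Arzela-Ascoli gives a uniformly convergent subsequence, and dominated
  convergence carries the integral equation to the limit. The global bound \<open>M\<close> rules
  out blow-up, so the solution lives on the whole interval.\<close>

theorem peano_existence:
  fixes f :: "real \<Rightarrow> 'a::euclidean_space \<Rightarrow> 'a"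
  assumes cont: "continuous_on ({0..T} \<times> UNIV) (\<lambda>(t, x). f t x)"
    and bound: "\<And>t x. t \<in> {0..T} \<Longrightarrow> norm (f t x) \<le> M"
  obtains x where "x 0 = x0"
    "\<And>t. t \<in> {0..T} \<Longrightarrow> (x has_vector_derivative f t (x t)) (at t within {0..T})"
proof (cases "T \<ge> 0")
  \<comment> \<open>The time interval is empty, so only the initial condition remains.\<close>
  case False
  then show ?thesis by (intro that[of "\<lambda>_. x0"]) auto
next
  case True
  have M: "M \<ge> 0" using order_trans[OF norm_ge_zero bound[of 0 x0]] True by simp
  define h where "h n = inverse (real (Suc n))" for n
  have h: "h n > 0" for n by (simp add: h_def)
  have "\<exists>x. continuous_on {0..T} x \<and>
    (\<forall>t\<in>{0..T}. x t = x0 + integral {0..t} (\<lambda>s. f s (x (max 0 (s - h n)))))" for n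
    by (rule tonelli_delayed_solution[OF cont h[of n], of x0]) blast
  then obtain y where y_cont: "\<And>n. continuous_on {0..T} (y n)"
    and y: "\<And>n t. t \<in> {0..T} \<Longrightarrow> y n t = x0 + integral {0..t} (\<lambda>s. f s (y n (max 0 (s - h n))))"
    by metis
  have f_cont: "continuous_on {0..T} (\<lambda>s. f s (g s))" if "continuous_on {0..T} g" for g
  proof -
    have "continuous_on {0..T} (\<lambda>s. case (s, g s) of (t, x) \<Rightarrow> f t x)"
      using that by (intro continuous_on_compose2[OF cont]) (auto intro!: continuous_intros)
    then show ?thesis by simp
  qed
  have int_cont: "continuous_on {0..T} (\<lambda>s. f s (y n (max 0 (s - h n))))" for n
  proof (rule f_cont)
    show "continuous_on {0..T} (\<lambda>s. y n (max 0 (s - h n)))"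
      by (rule continuous_on_compose2[OF y_cont]) (use h[of n] in \<open>auto intro!: continuous_intros\<close>)
  qed
  have y_deriv: "(y n has_vector_derivative f t (y n (max 0 (t - h n)))) (at t within {0..T})"
    if t: "t \<in> {0..T}" for n t
  proof -
    have "((\<lambda>u. x0 + integral {0..u} (\<lambda>s. f s (y n (max 0 (s - h n))))) has_vector_derivative
        f t (y n (max 0 (t - h n)))) (at t within {0..T})"
      using integral_has_vector_derivative[OF int_cont[of n] t]
      by (auto intro!: derivative_eq_intros)
    then show ?thesis
      by (rule has_vector_derivative_transform[OF t y, rotated])
  qed
  \<comment> \<open>The bound on \<open>f\<close> does not see the delay, hence one Lipschitz
    constant serves every \<open>n\<close>.\<close>
  have lip: "norm (y n s - y n t) \<le> M * \<bar>s - t\<bar>" if "s \<in> {0..T}" "t \<in> {0..T}" for n s t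
  proof -
    have "norm (y n s - y n t) \<le> M * norm (s - t)"
    proof (rule differentiable_bound[of "{0..T}" "y n"])
      show "(y n has_derivative (\<lambda>r. r *\<^sub>R f x (y n (max 0 (x - h n))))) (at x within {0..T})"
        if "x \<in> {0..T}" for x
        using y_deriv[OF that] by (simp add: has_vector_derivative_def)
      show "onorm (\<lambda>r. r *\<^sub>R f x (y n (max 0 (x - h n)))) \<le> M" if "x \<in> {0..T}" for x
      proof (rule onorm_le)
        fix r :: real
        show "norm (r *\<^sub>R f x (y n (max 0 (x - h n)))) \<le> M * norm r"
          using mult_right_mono[OF bound[OF that], of "norm r"] by (simp add: mult.commute)
      qed
    qed (use that in auto)
    then show ?thesis by simp
  qed
  have y0: "y n 0 = x0" for n using y[of 0 n] True by simp
  have y_bound: "norm (y n t) \<le> norm x0 + M * T" if "t \<in> {0..T}" for n t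
  proof -
    have "norm (y n t) \<le> norm (y n 0) + norm (y n t - y n 0)"
      by (rule norm_triangle_sub)
    also have "norm (y n t - y n 0) \<le> M * T"
      using lip[OF that, of 0 n] True that mult_left_mono[of t T M] M by auto
    finally show ?thesis by (simp add: y0)
  qed
  \<comment> \<open>The witness divides by \<open>M + 1\<close> because \<open>M\<close> may be
    \<open>0\<close>.\<close>
  have equicont: "\<exists>d>0. \<forall>n u. u \<in> {0..T} \<and> norm (t - u) < d \<longrightarrow> norm (y n t - y n u) < e"
    if "t \<in> {0..T}" "e > 0" for t e
  proof (intro exI[of _ "e / (M + 1)"] conjI allI impI)
    fix n u assume u: "u \<in> {0..T} \<and> norm (t - u) < e / (M + 1)"
    have "norm (y n t - y n u) \<le> M * \<bar>t - u\<bar>" using lip that u by blast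
    also have "\<dots> \<le> (M + 1) * \<bar>t - u\<bar>" by (simp add: mult_right_mono)
    also have "\<dots> < e" using u M by (simp add: field_simps)
    finally show "norm (y n t - y n u) < e" .
  qed (use M that in auto)
  obtain g k where g: "continuous_on {0..T} g" and k: "strict_mono (k :: nat \<Rightarrow> nat)"
    and lim: "\<And>e. 0 < e \<Longrightarrow> \<exists>N. \<forall>n t. n \<ge> N \<and> t \<in> {0..T} \<longrightarrow> norm (y (k n) t - g t) < e"
    by (rule Arzela_Ascoli[OF compact_Icc y_bound equicont]) (assumption | rule that)+
  have y_lim: "(\<lambda>n. y (k n) t) \<longlonglongrightarrow> g t" if "t \<in> {0..T}" for t
  proof (rule LIMSEQ_I)
    fix e :: real assume "e > 0"
    from lim[OF this] that show "\<exists>N. \<forall>n\<ge>N. norm (y (k n) t - g t) < e" by blast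
  qed
  have h_lim: "(\<lambda>n. h (k n)) \<longlonglongrightarrow> 0"
    using LIMSEQ_subseq_LIMSEQ[OF LIMSEQ_inverse_real_of_nat k] by (simp add: h_def o_def)
  \<comment> \<open>The delayed time differs from \<open>t\<close> by at most
    \<open>h (k n)\<close>, so by the common Lipschitz constant the delay disappears in the
    limit.\<close>
  have delay_lim: "(\<lambda>n. y (k n) (max 0 (t - h (k n)))) \<longlonglongrightarrow> g t" if t: "t \<in> {0..T}" for t
  proof -
    have delay: "norm (y (k n) (max 0 (t - h (k n))) - y (k n) t) \<le> M * h (k n)" for n
    proof -
      have "norm (y (k n) (max 0 (t - h (k n))) - y (k n) t) \<le> M * \<bar>max 0 (t - h (k n)) - t\<bar>"
        using t h[of "k n"] by (intro lip) auto
      also have "\<dots> \<le> M * h (k n)"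
        using t h[of "k n"] M by (intro mult_left_mono) (auto simp: max_def)
      finally show ?thesis .
    qed
    have "(\<lambda>n. M * h (k n)) \<longlonglongrightarrow> 0"
      using tendsto_mult_left[OF h_lim, of M] by simp
    then have "(\<lambda>n. y (k n) (max 0 (t - h (k n))) - y (k n) t) \<longlonglongrightarrow> 0"
      by (rule Lim_null_comparison[OF always_eventually[OF allI[OF delay]]])
    from tendsto_add[OF this y_lim[OF t]] show ?thesis by simp
  qed
  have g_eq: "g t = x0 + integral {0..t} (\<lambda>s. f s (g s))" if t: "t \<in> {0..T}" for t
  proof (rule LIMSEQ_unique[OF y_lim[OF t]])
    have "(\<lambda>n. integral {0..t} (\<lambda>s. f s (y (k n) (max 0 (s - h (k n))))))
        \<longlonglongrightarrow> integral {0..t} (\<lambda>s. f s (g s))"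
    proof (rule dominated_convergence(2))
      show "(\<lambda>s. f s (y (k n) (max 0 (s - h (k n))))) integrable_on {0..t}" for n
        by (rule integrable_continuous_real continuous_on_subset[OF int_cont])+ (use t in auto)
      show "(\<lambda>_. M) integrable_on {0..t}" by (rule integrable_const_ivl)
      show "norm (f s (y (k n) (max 0 (s - h (k n))))) \<le> M" if "s \<in> {0..t}" for n s
        using t that by (intro bound) auto
      fix s assume "s \<in> {0..t}"
      with t have s: "s \<in> {0..T}" by auto
      have "(\<lambda>n. case (s, y (k n) (max 0 (s - h (k n)))) of (t, x) \<Rightarrow> f t x)
          \<longlonglongrightarrow> (case (s, g s) of (t, x) \<Rightarrow> f t x)"
        by (rule continuous_on_tendsto_compose[OF cont])
          (use s in \<open>auto intro!: tendsto_Pair delay_lim\<close>)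
      then show "(\<lambda>n. f s (y (k n) (max 0 (s - h (k n))))) \<longlonglongrightarrow> f s (g s)" by simp
    qed
    then show "(\<lambda>n. y (k n) t) \<longlonglongrightarrow> x0 + integral {0..t} (\<lambda>s. f s (g s))"
      unfolding y[OF t] by (intro tendsto_intros)
  qed
  show ?thesis
  proof
    show "g 0 = x0" using g_eq[of 0] True by simp
    fix t assume t: "t \<in> {0..T}"
    have "((\<lambda>u. x0 + integral {0..u} (\<lambda>s. f s (g s))) has_vector_derivative f t (g t))
        (at t within {0..T})"
      using integral_has_vector_derivative[OF f_cont[OF g] t]
      by (auto intro!: derivative_eq_intros)
    then show "(g has_vector_derivative f t (g t)) (at t within {0..T})"
      by (rule has_vector_derivative_transform[OF t g_eq, rotated])
  qed
qed

section \<open>Scalar decay estimates and a continuity argument\<close>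

text \<open>With the integrating factor, \<open>exp (a * s) * (y s - c / a)\<close> has derivative
  \<open>exp (a * s) * (g s - c)\<close>, which is nonpositive; its initial value is nonpositive
  because \<open>c \<ge> 0\<close>.\<close>

lemma linear_decay_upper:
  fixes y g :: "real \<Rightarrow> real"
  assumes y0: "y 0 = 0" and a: "a > 0" and t: "0 \<le> t"
    and deriv: "\<And>s. s \<in> {0..t} \<Longrightarrow> (y has_vector_derivative - a * y s + g s) (at s within {0..t})"
    and g: "\<And>s. s \<in> {0..t} \<Longrightarrow> g s \<le> c" and c: "c \<ge> 0"
  shows "y t \<le> c / a"
proof -
  define z where "z s = exp (a * s) * (y s - c / a)" for s
  have "z 0 \<ge> z t"
  proof (rule DERIV_nonpos_imp_decreasing_open[OF t])
    have "continuous_on {0..t} y"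
      by (rule continuous_on_vector_derivative) (rule deriv)
    then show "continuous_on {0..t} z"
      unfolding z_def by (intro continuous_intros)
    fix s assume s: "0 < s" "s < t"
    then have "(y has_vector_derivative - a * y s + g s) (at s)"
      using deriv[of s] at_within_Icc_at[of 0 s t] by simp
    then have "DERIV y s :> - a * y s + g s"
      by (simp add: has_real_derivative_iff_has_vector_derivative)
    then have "DERIV z s :> exp (a * s) * (g s - c)"
      unfolding z_def using a
      by (auto intro!: derivative_eq_intros simp: field_simps)
    moreover have "exp (a * s) * (g s - c) \<le> 0"
      using g[of s] s by (simp add: mult_nonneg_nonpos)
    ultimately show "\<exists>d. DERIV z s :> d \<and> d \<le> 0" by blast
  qed
  moreover have "z 0 \<le> 0" using a c by (simp add: z_def y0)
  ultimately have "exp (a * t) * (y t - c / a) \<le> 0" by (simp add: z_def)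
  then show ?thesis by (simp add: mult_le_0_iff)
qed

text \<open>The one-sided estimate is applied to \<open>y\<close> and to \<open>- y\<close>.
  Replacing the rate \<open>a\<close> by its lower bound \<open>\<rho>\<close> makes the result the
  same for all components.\<close>

lemma linear_decay_bound:
  fixes y g :: "real \<Rightarrow> real"
  assumes "y 0 = 0" and "0 < \<rho>" "\<rho> \<le> a" and "0 \<le> t"
    and deriv: "\<And>s. s \<in> {0..t} \<Longrightarrow> (y has_vector_derivative - a * y s + g s) (at s within {0..t})"
    and g: "\<And>s. s \<in> {0..t} \<Longrightarrow> \<bar>g s\<bar> \<le> c"
  shows "\<bar>y t\<bar> \<le> c / \<rho>"
proof -
  have c: "c \<ge> 0" using g[of 0] assms(4) by simp
  have "y t \<le> c / a"
    by (rule linear_decay_upper[OF assms(1) _ assms(4) deriv _ c]) (use assms in \<open>auto simp: abs_le_iff\<close>)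
  moreover have "- y t \<le> c / a"
  proof (rule linear_decay_upper[where g = "\<lambda>s. - g s" and y = "\<lambda>s. - y s"])
    fix s assume s: "s \<in> {0..t}"
    show "((\<lambda>s. - y s) has_vector_derivative - a * - y s + - g s) (at s within {0..t})"
      using has_vector_derivative_minus[OF deriv[OF s]] by simp
    show "- g s \<le> c" using g[OF s] by simp
  qed (use assms c in auto)
  moreover have "c / a \<le> c / \<rho>" using assms c by (intro divide_left_mono) auto
  ultimately show ?thesis by simp
qed

text \<open>If \<open>u\<close> ever reached \<open>m'\<close>, then up to the first such time the
  weak bound \<open>m'\<close> would hold, and \<open>step\<close> would improve it to
  \<open>m < m'\<close> at that very time.\<close>

lemma bootstrap_bound:
  fixes u :: "real \<Rightarrow> real"
  assumes cont: "continuous_on {0..T} u" and "u 0 \<le> m" and mm: "m < m'"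
    and step: "\<And>t. t \<in> {0..T} \<Longrightarrow> (\<And>s. s \<in> {0..t} \<Longrightarrow> u s \<le> m') \<Longrightarrow> u t \<le> m"
    and t: "t \<in> {0..T}"
  shows "u t \<le> m"
proof -
  have "u s < m'" if "s \<in> {0..T}" for s
  proof (rule ccontr)
    assume "\<not> u s < m'"
    define K where "K = {s \<in> {0..T}. m' \<le> u s}"
    have "closed K"
      unfolding K_def by (rule continuous_on_closed_Collect_le) (auto intro: cont)
    moreover have "bounded K"
      using bounded_subset[OF bounded_closed_interval[of 0 T], of K] unfolding K_def by blast
    ultimately have "compact K" by (simp add: compact_eq_bounded_closed)
    moreover have "K \<noteq> {}" using that \<open>\<not> u s < m'\<close> by (auto simp: K_def)
    ultimately obtain t0 where t0: "t0 \<in> K" "\<And>r. r \<in> K \<Longrightarrow> t0 \<le> r"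
      using compact_attains_inf by metis
    then have T0: "t0 \<in> {0..T}" "m' \<le> u t0" by (auto simp: K_def)
    \<comment> \<open>Intermediate values and minimality of \<open>t0\<close> force
      \<open>u t0 = m'\<close> exactly, so the weak bound includes the endpoint \<open>t0\<close>,
      as \<open>step\<close> demands.\<close>
    obtain r where r: "0 \<le> r" "r \<le> t0" "u r = m'"
      using IVT'[of u 0 m' t0] T0 assms(2) mm continuous_on_subset[OF cont, of "{0..t0}"] by force
    then have "u t0 = m'" using t0(2)[of r] T0 by (auto simp: K_def)
    moreover have "u q \<le> m'" if "q \<in> {0..t0}" for q
      using t0(2)[of q] that T0 \<open>u t0 = m'\<close> by (cases "q = t0") (force simp: K_def)+
    ultimately show False using step[OF T0(1)] mm by fastforce
  qed
  then show ?thesis using step[OF t] t by (force simp: less_imp_le)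
qed


section \<open>Components of states and of the exact state equation\<close>

text \<open>States are measured in the sup norm because all estimates come component by
  component.\<close>

lemma infnorm_le_iff_cart: "infnorm (x :: real ^ 'l) \<le> m \<longleftrightarrow> (\<forall>l. \<bar>x $ l\<bar> \<le> m)"
proof -
  have "infnorm x = Max (range (\<lambda>l. \<bar>x $ l\<bar>))"
  proof -
    have "(\<lambda>i. \<bar>x \<bullet> i\<bar>) ` Basis = range (\<lambda>l. \<bar>x $ l\<bar>)"
      by (force simp: Basis_vec_def inner_axis image_iff)
    then show ?thesis by (simp add: infnorm_Max)
  qed
  then show ?thesis by simp
qed

text \<open>The box form supplies compactness and the retraction \<open>clamp\<close>.\<close>

lemma infnorm_ball_eq_cbox: "{x :: real ^ 'l. infnorm x \<le> m} = cbox (\<chi> l. - m) (\<chi> l. m)"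
  by (auto simp: infnorm_le_iff_cart mem_box_cart abs_le_iff minus_le_iff)

text \<open>Diagonality decouples the state equation into scalar ones, to which the decay bounds
  apply.\<close>

lemma G_PC_nth: "G_PC \<alpha> \<beta> (r, x) $ l = - \<alpha> $ l * r $ l + x * \<beta> $ l"
proof -
  have "(\<Sum>j\<in>UNIV. (if l = j then \<alpha> $ l else 0) * r $ j) = (\<Sum>j\<in>UNIV. if l = j then \<alpha> $ l * r $ l else 0)"
    by (rule sum.cong) auto
  then show ?thesis
    by (simp add: G_PC_def diag_def matrix_vector_mult_def)
qed

lemma has_vector_derivative_nth:
  assumes "(\<xi> has_vector_derivative v) (at t within S)"
  shows "((\<lambda>t. \<xi> t $ l) has_vector_derivative v $ l) (at t within S)"
  using bounded_linear.has_vector_derivative[OF bounded_linear_vec_nth assms] .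

section \<open>Confinement, comparison and existence of states\<close>

text \<open>The error bound \<open>near\<close> is available only inside the box of radius
  \<open>m\<close>; \<open>bootstrap_bound\<close> closes this circle, since the decay estimate
  returns a strictly smaller radius. The right-hand side is an arbitrary \<open>H\<close> along the
  trajectory, so that network states and states of a clamped equation are both covered.\<close>

lemma state_bound:
  fixes \<xi> H :: "real \<Rightarrow> real ^ 'l"
  assumes "\<xi> 0 = 0"
    and deriv: "\<And>t. t \<in> {0..T} \<Longrightarrow> (\<xi> has_vector_derivative H t) (at t within {0..T})"
    and \<rho>: "0 < \<rho>" "\<And>l. \<rho> \<le> \<alpha> $ l" and \<beta>: "\<And>l. \<bar>\<beta> $ l\<bar> \<le> B"
    and b: "\<And>t. t \<in> {0..T} \<Longrightarrow> \<bar>b t\<bar> \<le> R"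
    and near: "\<And>t. t \<in> {0..T} \<Longrightarrow> infnorm (\<xi> t) \<le> m \<Longrightarrow> norm (H t - G_PC \<alpha> \<beta> (\<xi> t, b t)) \<le> \<delta>"
    and m: "(R * B + \<delta>) / \<rho> < m"
    and nonneg: "0 \<le> R * B + \<delta>"
    and t: "t \<in> {0..T}"
  shows "infnorm (\<xi> t) \<le> (R * B + \<delta>) / \<rho>"
proof (rule bootstrap_bound[OF _ _ m _ t])
  have "continuous_on {0..T} \<xi>"
    by (rule continuous_on_vector_derivative) (rule deriv)
  then show "continuous_on {0..T} (\<lambda>t. infnorm (\<xi> t))"
    by (rule continuous_on_infnorm)
  show "infnorm (\<xi> 0) \<le> (R * B + \<delta>) / \<rho>"
    using nonneg \<rho> by (simp add: assms(1) infnorm_0)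
  fix t assume t: "t \<in> {0..T}" and le: "\<And>s. s \<in> {0..t} \<Longrightarrow> infnorm (\<xi> s) \<le> m"
  show "infnorm (\<xi> t) \<le> (R * B + \<delta>) / \<rho>"
    unfolding infnorm_le_iff_cart
  proof
    fix l
    show "\<bar>\<xi> t $ l\<bar> \<le> (R * B + \<delta>) / \<rho>"
    proof (rule linear_decay_bound[where y = "\<lambda>s. \<xi> s $ l" and t = t, OF _ \<rho>(1) \<rho>(2)[of l]])
      fix s assume s: "s \<in> {0..t}"
      then have s': "s \<in> {0..T}" using t by auto
      have "(\<xi> has_vector_derivative H s) (at s within {0..t})"
        using has_vector_derivative_within_subset[OF deriv[OF s']] t by auto
      \<comment> \<open>The forcing is what \<open>H\<close> leaves after the decay term is split
        off: \<open>b s * \<beta> $ l\<close> plus the approximation error.\<close>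
      then show "((\<lambda>s. \<xi> s $ l) has_vector_derivative
          - (\<alpha> $ l) * \<xi> s $ l + (H s $ l + \<alpha> $ l * \<xi> s $ l)) (at s within {0..t})"
        by (simp add: has_vector_derivative_nth)
      have "\<bar>(H s - G_PC \<alpha> \<beta> (\<xi> s, b s)) $ l\<bar> \<le> \<delta>"
        using component_le_norm_cart near[OF s' le[OF s]] by (rule order_trans)
      moreover have "\<bar>b s * \<beta> $ l\<bar> \<le> R * B"
        unfolding abs_mult using b[OF s'] \<beta>[of l] by (intro mult_mono) auto
      ultimately show "\<bar>H s $ l + \<alpha> $ l * \<xi> s $ l\<bar> \<le> R * B + \<delta>"
        by (simp add: G_PC_nth)
    qed (use t assms(1) in auto)
  qed
qed

text \<open>By linearity of \<open>G_PC\<close> the input terms cancel in the difference of the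
  states, which then decays under the approximation error alone. No factor growing with
  \<open>T\<close> arises, unlike in a Gronwall estimate.\<close>

lemma state_error:
  fixes \<xi> \<zeta> H :: "real \<Rightarrow> real ^ 'l"
  assumes \<xi>: "internal_state T (G_PC \<alpha> \<beta>) b \<xi>" and "\<zeta> 0 = 0"
    and deriv: "\<And>t. t \<in> {0..T} \<Longrightarrow> (\<zeta> has_vector_derivative H t) (at t within {0..T})"
    and \<rho>: "0 < \<rho>" "\<And>l. \<rho> \<le> \<alpha> $ l"
    and near: "\<And>t. t \<in> {0..T} \<Longrightarrow> norm (H t - G_PC \<alpha> \<beta> (\<zeta> t, b t)) \<le> \<delta>"
    and t: "t \<in> {0..T}"
  shows "\<bar>(\<zeta> t - \<xi> t) $ l\<bar> \<le> \<delta> / \<rho>"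
proof (rule linear_decay_bound[where y = "\<lambda>s. (\<zeta> s - \<xi> s) $ l" and t = t, OF _ \<rho>(1) \<rho>(2)[of l]])
  fix s assume s: "s \<in> {0..t}"
  then have s': "s \<in> {0..T}" using t by auto
  have "((\<lambda>s. \<zeta> s - \<xi> s) has_vector_derivative H s - G_PC \<alpha> \<beta> (\<xi> s, b s)) (at s within {0..T})"
    using \<xi> s' by (intro has_vector_derivative_diff deriv) (auto simp: internal_state_def)
  then have "((\<lambda>s. \<zeta> s - \<xi> s) has_vector_derivative H s - G_PC \<alpha> \<beta> (\<xi> s, b s)) (at s within {0..t})"
    by (rule has_vector_derivative_within_subset) (use t in auto)
  from has_vector_derivative_nth[OF this, of l]
  show "((\<lambda>s. (\<zeta> s - \<xi> s) $ l) has_vector_derivative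
      - (\<alpha> $ l) * (\<zeta> s - \<xi> s) $ l + (H s - G_PC \<alpha> \<beta> (\<zeta> s, b s)) $ l) (at s within {0..t})"
    by (simp add: G_PC_nth algebra_simps)
  show "\<bar>(H s - G_PC \<alpha> \<beta> (\<zeta> s, b s)) $ l\<bar> \<le> \<delta>"
    using component_le_norm_cart near[OF s'] by (rule order_trans)
qed (use t \<xi> assms(2) in \<open>auto simp: internal_state_def\<close>)

text \<open>\<open>G\<close> may be unbounded, so the state is clamped to a compact box before
  Peano's theorem is applied. By \<open>state_bound\<close> the resulting solution never leaves the
  box, hence it solves the original equation.\<close>

lemma internal_state_exists:
  fixes G :: "(real ^ 'l) \<times> real \<Rightarrow> real ^ 'l"
  assumes G: "continuous_on UNIV G" and b_cont: "continuous_on {0..T} b"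
    and \<rho>: "0 < \<rho>" "\<And>l. \<rho> \<le> \<alpha> $ l" and \<beta>: "\<And>l. \<bar>\<beta> $ l\<bar> \<le> B"
    and b: "\<And>t. t \<in> {0..T} \<Longrightarrow> \<bar>b t\<bar> \<le> R"
    and near: "\<And>r x. infnorm r \<le> m \<Longrightarrow> \<bar>x\<bar> \<le> R \<Longrightarrow> norm (G_PC \<alpha> \<beta> (r, x) - G (r, x)) \<le> \<delta>"
    and m: "(R * B + \<delta>) / \<rho> < m"
    and nonneg: "0 \<le> R * B + \<delta>"
  shows "\<exists>\<xi>. internal_state T G b \<xi>"
proof -
  \<comment> \<open>This makes the box nonempty; otherwise \<open>clamp\<close> need not map into
    it.\<close>
  have "m \<ge> 0" using m nonneg \<rho>(1) by (smt (verit) divide_nonneg_pos)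
  define P :: "real ^ 'l \<Rightarrow> real ^ 'l" where "P = clamp (\<chi> l. - m) (\<chi> l. m)"
  have P_cont: "continuous_on S P" for S
    unfolding P_def using clamp_continuous_on[OF continuous_on_id] by auto
  have P_box: "P x \<in> cbox (\<chi> l. - m) (\<chi> l. m)" for x
    unfolding P_def using \<open>m \<ge> 0\<close> by (intro clamp_in_interval) (auto simp: Basis_vec_def inner_axis)
  have P_id: "P x = x" if "infnorm x \<le> m" for x
    unfolding P_def using that infnorm_ball_eq_cbox[of m] by (intro clamp_cancel_cbox) auto
  let ?D = "cbox (\<chi> l. - m) (\<chi> l. m) \<times> {- R..R}"
  have "bounded (G ` ?D)"
    by (intro compact_imp_bounded compact_continuous_image continuous_on_subset[OF G]
        compact_Times compact_cbox compact_Icc) simp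
  then obtain M where "\<forall>w\<in>G ` ?D. norm w \<le> M"
    by (auto simp only: bounded_iff)
  then have M: "norm (G z) \<le> M" if "z \<in> ?D" for z
    using that by blast
  obtain \<xi> where \<xi>: "\<xi> 0 = 0"
    "\<And>t. t \<in> {0..T} \<Longrightarrow> (\<xi> has_vector_derivative G (P (\<xi> t), b t)) (at t within {0..T})"
  proof (rule peano_existence[of T "\<lambda>t x. G (P x, b t)" M 0])
    have "continuous_on ({0..T} \<times> UNIV) (\<lambda>z. G (P (snd z), b (fst z)))"
      by (intro continuous_on_compose2[OF G] continuous_intros continuous_on_compose2[OF b_cont]
          continuous_on_compose2[OF P_cont[of UNIV]]) auto
    then show "continuous_on ({0..T} \<times> UNIV) (\<lambda>(t, x). G (P x, b t))"
      by (simp add: case_prod_beta)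
    show "norm (G (P x, b t)) \<le> M" if "t \<in> {0..T}" for t x
      using b[OF that] P_box[of x] by (intro M) (auto simp: abs_le_iff)
  qed blast
  \<comment> \<open>The premise \<open>near\<close> of \<open>state_bound\<close> concerns only
    states inside the box, where the clamping \<open>P\<close> is the identity.\<close>
  have "infnorm (\<xi> t) \<le> (R * B + \<delta>) / \<rho>" if t: "t \<in> {0..T}" for t
  proof (rule state_bound[OF \<xi> \<rho> \<beta> b _ m nonneg t])
    show "norm (G (P (\<xi> t), b t) - G_PC \<alpha> \<beta> (\<xi> t, b t)) \<le> \<delta>"
      if "t \<in> {0..T}" "infnorm (\<xi> t) \<le> m" for t
      using near[OF that(2) b[OF that(1)]] by (simp add: P_id[OF that(2)] norm_minus_commute)
  qed
  then have "P (\<xi> t) = \<xi> t" if "t \<in> {0..T}" for t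
    using that m by (intro P_id) fastforce
  then have "internal_state T G b \<xi>"
    using \<xi> by (simp add: internal_state_def)
  then show ?thesis by blast
qed

section \<open>The exact maps, approximability and admissible inputs\<close>

lemma continuous_on_G_PC: "continuous_on UNIV (G_PC \<alpha> \<beta>)"
  unfolding G_PC_def case_prod_beta
  by (intro continuous_intros linear_continuous_on_compose[OF _ matrix_vector_mul_linear])

text \<open>Only the sum of the internal variables differs, whence one \<open>d\<close> per
  component.\<close>

lemma F_PC_diff_le:
  fixes r r' :: "real ^ 'l" and d :: real
  assumes "\<And>l. \<bar>(r' - r) $ l\<bar> \<le> d"
  shows "\<bar>F_PC E' \<nu>' (b, c, r) - F_PC E' \<nu>' (b, c, r')\<bar> \<le> CARD('l) * d"
proof -
  have "F_PC E' \<nu>' (b, c, r) - F_PC E' \<nu>' (b, c, r') = (\<Sum>l\<in>UNIV. (r' - r) $ l)"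
    by (simp add: F_PC_def inner_vec_def sum_subtractf)
  also have "\<bar>\<dots>\<bar> \<le> (\<Sum>l\<in>UNIV. \<bar>(r' - r) $ l\<bar>)"
    by (rule sum_abs)
  also have "\<dots> \<le> CARD('l) * d"
    using sum_bounded_above[of UNIV "\<lambda>l. \<bar>(r' - r) $ l\<bar>" d] assms by simp
  finally show ?thesis .
qed

lemma approximable_byE:
  assumes "approximable_by f N" "compact D" "\<delta> > 0"
  obtains g where "g \<in> N" "\<And>z. z \<in> D \<Longrightarrow> norm (f z - g z) \<le> \<delta>"
proof -
  have "\<exists>g\<in>N. \<forall>z\<in>D. norm (f z - g z) \<le> \<delta>"
    using assms(1)[unfolded approximable_by_def, rule_format, OF conjI, OF assms(2,3)] .
  then show ?thesis using that by blast
qed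

lemma Z_bound:
  assumes "w \<in> Z T R" "t \<in> {0<..<T}"
  shows "\<bar>w t\<bar> \<le> R"
proof -
  have "ereal \<bar>w t\<bar> \<le> (SUP t\<in>{0<..<T}. ereal \<bar>w t\<bar>)"
    using assms(2) by (rule SUP_upper)
  also have "\<dots> \<le> ereal R" using assms(1) by (simp add: Z_def)
  finally show ?thesis by simp
qed

text \<open>\<open>Z\<close> controls the open interval only, while the state equation is posed up
  to both endpoints; continuity extends the bound.\<close>

lemma Z_bound_closure:
  assumes "w \<in> Z T R" "continuous_on {0..T} w" "T > 0" "t \<in> {0..T}"
  shows "\<bar>w t\<bar> \<le> R"
proof -
  have "norm (w t) \<le> R"
    by (rule continuous_on_closure_norm_le[of "{0<..<T}"]) (use assms in \<open>auto dest: Z_bound\<close>)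
  then show ?thesis by simp
qed

section \<open>Choice of the networks and the final estimate\<close>

text \<open>The supremum ranges over every network state, since solutions may be non-unique. The
  clauses on \<open>is_singleton\<close> and nonemptiness keep it from being vacuous: an empty
  supremum would satisfy any bound.\<close>

theorem theorem3p10:
  fixes T R \<rho> B E' \<nu>' \<eta> :: real
    and E \<nu> :: "real \<Rightarrow> real"
    and \<alpha> \<beta> :: "real ^ 'l"
    and NF :: "(real \<times> real \<times> (real ^ 'l) \<Rightarrow> real) set"
    and NG :: "((real ^ 'l) \<times> real \<Rightarrow> real ^ 'l) set"
  assumes "T > 0"
    and "piecewise_constant_material (CARD('l) + 1) E \<nu>"
    and "ess_sup E < \<infinity>" and "ess_sup \<nu> < \<infinity>"
    and "ess_inf E > 0" and "ess_inf \<nu> > 0"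
    and "homogenized_parameters E \<nu> E' \<nu>' \<alpha> \<beta>"
    and "\<rho> > 0" and "B \<ge> 0"
    and "\<rho> < Min (range (\<lambda>l. \<bar>\<alpha> $ l\<bar>))"
    and "Max (range (\<lambda>l. \<bar>\<beta> $ l\<bar>)) \<le> B"
    and "R > 0"
    and "\<And>F. F \<in> NF \<Longrightarrow> continuous_on UNIV F"
    and "\<And>G. G \<in> NG \<Longrightarrow> continuous_on UNIV G"
    and "approximable_by (F_PC E' \<nu>') NF"
    and "approximable_by (G_PC \<alpha> \<beta>) NG"
    and "\<eta> > 0"
  shows "\<exists>F_RNN\<in>NF. \<exists>G_RNN\<in>NG.
    (\<forall>b\<in>Z T R. \<forall>c\<in>Z T R. \<forall>t\<in>{0<..<T}. continuous_on {0..T} b \<longrightarrow>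
       is_singleton (\<Psi>\<^sub>0 T (F_PC E' \<nu>') (G_PC \<alpha> \<beta>) b c t) \<and>
       \<Psi>\<^sub>0 T F_RNN G_RNN b c t \<noteq> {}) \<and>
    Sup {ereal \<bar>p - q\<bar> |p q b c t. t \<in> {0<..<T} \<and> b \<in> Z T R \<and> c \<in> Z T R \<and> continuous_on {0..T} b \<and>
           p \<in> \<Psi>\<^sub>0 T (F_PC E' \<nu>') (G_PC \<alpha> \<beta>) b c t \<and> q \<in> \<Psi>\<^sub>0 T F_RNN G_RNN b c t} < ereal \<eta>"
proof -
  \<comment> \<open>Nonnegativity turns the lower bound on the absolute values into one on the decay
    rates.\<close>
  have "\<alpha> $ l \<ge> 0" for l
    using assms(7) by (simp add: homogenized_parameters_def)
  then have \<alpha>: "\<rho> \<le> \<alpha> $ l" for l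
    using assms(10) by (simp add: less_imp_le)
  have \<beta>: "\<bar>\<beta> $ l\<bar> \<le> B" for l
    using assms(11) by simp
  \<comment> \<open>The second entry makes \<open>CARD('l) * (\<delta> / \<rho>)\<close> at most
    \<open>\<eta> / 4\<close>. The cap \<open>1\<close> allows a radius \<open>m\<close> depending
    on \<open>R\<close>, \<open>B\<close> and \<open>\<rho>\<close> only, strictly above
    \<open>(R * B + \<delta>) / \<rho>\<close>.\<close>
  define \<delta> where "\<delta> = min 1 (\<rho> * \<eta> / (4 * CARD('l)))"
  define m where "m = (R * B + 1) / \<rho> + 1"
  have \<delta>: "0 < \<delta>" "\<delta> \<le> 1" "\<delta> \<le> \<rho> * \<eta> / (4 * CARD('l))"
    using \<open>\<rho> > 0\<close> \<open>\<eta> > 0\<close> by (auto simp: \<delta>_def)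
  have nonneg: "0 \<le> R * B + \<delta>" using \<open>R > 0\<close> \<open>B \<ge> 0\<close> \<delta> by simp
  have "(R * B + \<delta>) / \<rho> \<le> (R * B + 1) / \<rho>"
    using \<delta> \<open>\<rho> > 0\<close> by (intro divide_right_mono) auto
  then have m: "(R * B + \<delta>) / \<rho> < m" by (simp add: m_def)
  have box: "compact {r :: real ^ 'l. infnorm r \<le> m}"
    by (simp add: infnorm_ball_eq_cbox)
  have \<eta>4: "\<eta> / 4 > 0" using \<open>\<eta> > 0\<close> by simp
  have "compact ({- R..R} \<times> {- R..R} \<times> {r :: real ^ 'l. infnorm r \<le> m})"
    by (intro compact_Times box compact_Icc)
  then obtain F where F: "F \<in> NF"
    and F_near: "\<And>z. z \<in> {- R..R} \<times> {- R..R} \<times> {r. infnorm r \<le> m} \<Longrightarrow> norm (F_PC E' \<nu>' z - F z) \<le> \<eta> / 4"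
    using \<eta>4 by (rule approximable_byE[OF assms(15)]) (rule that)
  have "compact ({r :: real ^ 'l. infnorm r \<le> m} \<times> {- R..R})"
    by (intro compact_Times box compact_Icc)
  then obtain G where G: "G \<in> NG"
    and G_approx: "\<And>z. z \<in> {r. infnorm r \<le> m} \<times> {- R..R} \<Longrightarrow> norm (G_PC \<alpha> \<beta> z - G z) \<le> \<delta>"
    using \<delta>(1) by (rule approximable_byE[OF assms(16)]) (rule that)
  have G_near: "norm (G_PC \<alpha> \<beta> (r, x) - G (r, x)) \<le> \<delta>" if "infnorm r \<le> m" "\<bar>x\<bar> \<le> R" for r x
    by (rule G_approx) (use that in \<open>simp add: abs_le_iff minus_le_iff\<close>)
  have singleton: "is_singleton (\<Psi>\<^sub>0 T (F_PC E' \<nu>') (G_PC \<alpha> \<beta>) b c t)"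
    and nonempty: "\<Psi>\<^sub>0 T F G b c t \<noteq> {}"
    if b: "b \<in> Z T R" "continuous_on {0..T} b" and t: "t \<in> {0<..<T}" for b c t
  proof -
    have bR: "\<And>t. t \<in> {0..T} \<Longrightarrow> \<bar>b t\<bar> \<le> R"
      using Z_bound_closure[OF b \<open>T > 0\<close>] .
    show "\<Psi>\<^sub>0 T F G b c t \<noteq> {}"
      using internal_state_exists[OF assms(14)[OF G] b(2) \<open>\<rho> > 0\<close> \<alpha> \<beta> bR G_near m nonneg]
      unfolding \<Psi>\<^sub>0_def by blast
    \<comment> \<open>The exact map approximates itself with error \<open>0\<close>, so the
      existence lemma for networks covers it too.\<close>
    have "\<exists>\<xi>. internal_state T (G_PC \<alpha> \<beta>) b \<xi>"
      by (rule internal_state_exists[OF continuous_on_G_PC b(2) \<open>\<rho> > 0\<close> \<alpha> \<beta> bR _ m nonneg])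
        (use \<delta> in auto)
    then obtain \<xi> where \<xi>: "internal_state T (G_PC \<alpha> \<beta>) b \<xi>" by blast
    \<comment> \<open>Uniqueness is the comparison estimate with error \<open>0\<close>.\<close>
    have unique: "\<zeta> t = \<xi> t" if \<zeta>: "internal_state T (G_PC \<alpha> \<beta>) b \<zeta>" for \<zeta>
    proof -
      have "\<bar>(\<zeta> t - \<xi> t) $ l\<bar> \<le> 0 / \<rho>" for l
        by (rule state_error[OF \<xi>, where H = "\<lambda>t. G_PC \<alpha> \<beta> (\<zeta> t, b t)"])
          (use \<zeta> t \<open>\<rho> > 0\<close> \<alpha> in \<open>auto simp: internal_state_def\<close>)
      then show ?thesis by (simp add: vec_eq_iff)
    qed
    have "\<Psi>\<^sub>0 T (F_PC E' \<nu>') (G_PC \<alpha> \<beta>) b c t = {F_PC E' \<nu>' (b t, c t, \<xi> t)}"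
    proof (intro subset_antisym[OF subsetI])
      fix p assume "p \<in> \<Psi>\<^sub>0 T (F_PC E' \<nu>') (G_PC \<alpha> \<beta>) b c t"
      then obtain \<zeta> where \<zeta>: "internal_state T (G_PC \<alpha> \<beta>) b \<zeta>" and p: "p = F_PC E' \<nu>' (b t, c t, \<zeta> t)"
        unfolding \<Psi>\<^sub>0_def by blast
      then show "p \<in> {F_PC E' \<nu>' (b t, c t, \<xi> t)}"
        using p unique[OF \<zeta>] by simp
    next
      show "{F_PC E' \<nu>' (b t, c t, \<xi> t)} \<subseteq> \<Psi>\<^sub>0 T (F_PC E' \<nu>') (G_PC \<alpha> \<beta>) b c t"
        using \<xi> unfolding \<Psi>\<^sub>0_def by blast
    qed
    then show "is_singleton (\<Psi>\<^sub>0 T (F_PC E' \<nu>') (G_PC \<alpha> \<beta>) b c t)"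
      by (simp add: is_singleton_def)
  qed
  \<comment> \<open>Aiming at \<open>\<eta> / 2\<close> keeps the inequality strict after passing to
    the supremum.\<close>
  have close: "\<bar>p - q\<bar> \<le> \<eta> / 2"
    if t: "t \<in> {0<..<T}" and b: "b \<in> Z T R" "continuous_on {0..T} b" and c: "c \<in> Z T R"
      and p: "p \<in> \<Psi>\<^sub>0 T (F_PC E' \<nu>') (G_PC \<alpha> \<beta>) b c t" and q: "q \<in> \<Psi>\<^sub>0 T F G b c t" for p q b c t
  proof -
    have bR: "\<And>t. t \<in> {0..T} \<Longrightarrow> \<bar>b t\<bar> \<le> R"
      using Z_bound_closure[OF b \<open>T > 0\<close>] .
    obtain \<xi> where \<xi>: "internal_state T (G_PC \<alpha> \<beta>) b \<xi>" and p_eq: "p = F_PC E' \<nu>' (b t, c t, \<xi> t)"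
      using p unfolding \<Psi>\<^sub>0_def by blast
    obtain \<zeta> where \<zeta>: "internal_state T G b \<zeta>" and q_eq: "q = F (b t, c t, \<zeta> t)"
      using q unfolding \<Psi>\<^sub>0_def by blast
    have \<zeta>0: "\<zeta> 0 = 0"
      and \<zeta>_deriv: "\<And>t. t \<in> {0..T} \<Longrightarrow> (\<zeta> has_vector_derivative G (\<zeta> t, b t)) (at t within {0..T})"
      using \<zeta> by (auto simp: internal_state_def)
    have near: "norm (G (\<zeta> t, b t) - G_PC \<alpha> \<beta> (\<zeta> t, b t)) \<le> \<delta>"
      if "t \<in> {0..T}" "infnorm (\<zeta> t) \<le> m" for t
      using G_near[OF that(2) bR[OF that(1)]] by (simp add: norm_minus_commute)
    have \<zeta>_box: "infnorm (\<zeta> t) \<le> m" if "t \<in> {0..T}" for t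
      using state_bound[OF \<zeta>0 \<zeta>_deriv \<open>\<rho> > 0\<close> \<alpha> \<beta> bR near m nonneg that] m by simp
    have t': "t \<in> {0..T}" using t by auto
    have state_diff: "\<bar>(\<zeta> t - \<xi> t) $ l\<bar> \<le> \<delta> / \<rho>" for l
      using state_error[OF \<xi> \<zeta>0 \<zeta>_deriv \<open>\<rho> > 0\<close> \<alpha> near[OF _ \<zeta>_box] t'] .
    \<comment> \<open>The intermediate value is \<open>F_PC\<close> at the network state
      \<open>\<zeta> t\<close>, known to lie in the box where \<open>F\<close> is accurate. State
      error and output error contribute \<open>\<eta> / 4\<close> each.\<close>
    have "\<bar>p - F_PC E' \<nu>' (b t, c t, \<zeta> t)\<bar> \<le> CARD('l) * (\<delta> / \<rho>)"
      unfolding p_eq by (rule F_PC_diff_le) (rule state_diff)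
    also have "\<dots> \<le> \<eta> / 4"
      using \<delta>(3) \<open>\<rho> > 0\<close> by (simp add: field_simps)
    finally have "\<bar>p - F_PC E' \<nu>' (b t, c t, \<zeta> t)\<bar> \<le> \<eta> / 4" .
    moreover have "norm (F_PC E' \<nu>' (b t, c t, \<zeta> t) - F (b t, c t, \<zeta> t)) \<le> \<eta> / 4"
      by (rule F_near) (use bR[OF t'] Z_bound[OF c t] \<zeta>_box[OF t'] in \<open>simp add: abs_le_iff minus_le_iff\<close>)
    ultimately show ?thesis unfolding q_eq real_norm_def by linarith
  qed
  have "Sup {ereal \<bar>p - q\<bar> |p q b c t. t \<in> {0<..<T} \<and> b \<in> Z T R \<and> c \<in> Z T R \<and> continuous_on {0..T} b \<and>
      p \<in> \<Psi>\<^sub>0 T (F_PC E' \<nu>') (G_PC \<alpha> \<beta>) b c t \<and> q \<in> \<Psi>\<^sub>0 T F G b c t} \<le> ereal (\<eta> / 2)"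
  proof (rule Sup_least, elim CollectE exE conjE)
    fix x p q b c t
    assume "x = ereal \<bar>p - q\<bar>" and "t \<in> {0<..<T}" "b \<in> Z T R" "c \<in> Z T R" "continuous_on {0..T} b"
      "p \<in> \<Psi>\<^sub>0 T (F_PC E' \<nu>') (G_PC \<alpha> \<beta>) b c t" "q \<in> \<Psi>\<^sub>0 T F G b c t"
    then show "x \<le> ereal (\<eta> / 2)" by (simp only: ereal_less_eq close)
  qed
  also have "\<dots> < ereal \<eta>" using \<open>\<eta> > 0\<close> by simp
  finally show ?thesis
    by (intro bexI[OF _ F] bexI[OF _ G] conjI ballI impI singleton nonempty)
qed

end
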